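(* Let $(P,\leq)$ be a directed poset, $\circ$ a binary operation on $P$, and $(P,\sqcup,\sqcap)$ a $\lambda$-lattice assigned to $(P,\leq)$. Then the following hold. (a) $(P,\leq,\circ)$ is a sectionally pseudocomplemented poset if and only if $(P,\sqcup,\sqcap,\circ)$ satisfies the following conditions: (i) for all $x,y\in P$: $y\sqcap(x\circ y)=y$; (ii) for all $x,y,z\in P$: if $\Big(\big((x\sqcup t)\sqcup(y\sqcup t)\big)\sqcap z\Big)\sqcap\big((x\circ y)\sqcap z\big)=z$ for all $t\in P$, then $z\sqcap y=z$; (iii) for all $x,y,z\in P$: if for every $s\in P$ the equivalence $$\Big[\Big(\big((x\sqcup t)\sqcup(y\sqcup t)\big)\sqcap s\Big)\sqcap(z\sqcap s)=s\ \text{ for all }t\in P\Big]\iff s\sqcap y=s$$ holds, then $z\sqcap(x\circ y)=z$. (b) If $1\in P$, then $(P,\leq,\circ,1)$ is a sectionally pseudocomplemented poset with $1$ if and only if $(P,\sqcup,\sqcap,\circ,1)$ satisfies (i), (ii), (iii) above as well as (iv) for all $x\in P$: $x\sqcap 1=x$.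
   Context: For a poset $(P,\leq)$ and $A\subseteq P$ let $L(A)=\{x\in P\mid x\leq a\text{ for all }a\in A\}$ and $U(A)=\{x\in P\mid a\leq x\text{ for all }a\in A\}$. Write $L(a)=L(\{a\})$, $L(a,b)=L(\{a,b\})$, $L(A,b)=L(A\cup\{b\})$, and similarly for $U$. The poset is directed if $L(x,y)\neq\emptyset$ and $U(x,y)\neq\emptyset$ for all $x,y\in P$. A $\lambda$-lattice assigned to a directed poset $(P,\leq)$ is an algebra $(P,\sqcup,\sqcap)$ with two binary operations such that for all $x,y\in P$: $x\sqcup y=y\sqcup x\in U(x,y)$ and $x\sqcap y=y\sqcap x\in L(x,y)$, and $x\sqcup y=\max(x,y)$, $x\sqcap y=\min(x,y)$ whenever $x$ and $y$ are comparable (for incomparable $x,y$ these are arbitrarily chosen elements of $U(x,y)$ and $L(x,y)$, respectively). A sectionally pseudocomplemented poset is a triple $(P,\leq,\circ)$ such that $(P,\leq)$ is a poset and $\circ$ is a binary operation on $P$ such that for all $x,y\in P$, $x\circ y$ is the greatest element $z$ of $P$ satisfying $L(U(x,y),z)=L(y)$. A sectionally pseudocomplemented poset with $1$ is a quadruple $(P,\leq,\circ,1)$ such that $(P,\leq,\circ)$ is a sectionally pseudocomplemented poset and $1$ is the top element of $(P,\leq)$. *)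

theory Defs
  imports "HOL-Algebra.Order"
begin

text \<open>
  Posets are the partial orders of HOL-Algebra, so the underlying set is a carrier (possibly
  empty). The cones are the library's \<open>Lower L A\<close> and \<open>Upper L A\<close>, and a binary
  operation on the carrier is an element of \<open>carrier L \<rightarrow> carrier L \<rightarrow> carrier L\<close>.
\<close>

locale directed_poset = partial_order L for L (structure) +
  assumes Lower_nonempty: "\<lbrakk>x \<in> carrier L; y \<in> carrier L\<rbrakk> \<Longrightarrow> Lower L {x, y} \<noteq> {}"
    and Upper_nonempty: "\<lbrakk>x \<in> carrier L; y \<in> carrier L\<rbrakk> \<Longrightarrow> Upper L {x, y} \<noteq> {}"

text \<open>
  For comparable elements, \<open>max(x,y)\<close> and \<open>min(x,y)\<close> are the greatest and the least
  element of \<open>{x, y}\<close>.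
\<close>

locale lambda_lattice = directed_poset L for L (structure) +
  fixes jn :: "'a \<Rightarrow> 'a \<Rightarrow> 'a" and mt :: "'a \<Rightarrow> 'a \<Rightarrow> 'a"
  assumes jn_commute: "\<lbrakk>x \<in> carrier L; y \<in> carrier L\<rbrakk> \<Longrightarrow> jn x y = jn y x"
    and jn_Upper: "\<lbrakk>x \<in> carrier L; y \<in> carrier L\<rbrakk> \<Longrightarrow> jn x y \<in> Upper L {x, y}"
    and mt_commute: "\<lbrakk>x \<in> carrier L; y \<in> carrier L\<rbrakk> \<Longrightarrow> mt x y = mt y x"
    and mt_Lower: "\<lbrakk>x \<in> carrier L; y \<in> carrier L\<rbrakk> \<Longrightarrow> mt x y \<in> Lower L {x, y}"
    and jn_max: "\<lbrakk>x \<in> carrier L; y \<in> carrier L; x \<sqsubseteq> y \<or> y \<sqsubseteq> x\<rbrakk>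
      \<Longrightarrow> greatest L (jn x y) {x, y}"
    and mt_min: "\<lbrakk>x \<in> carrier L; y \<in> carrier L; x \<sqsubseteq> y \<or> y \<sqsubseteq> x\<rbrakk>
      \<Longrightarrow> least L (mt x y) {x, y}"

locale sectionally_pseudocomplemented_poset = partial_order L for L (structure) +
  fixes imp :: "'a \<Rightarrow> 'a \<Rightarrow> 'a"
  assumes imp_closed: "imp \<in> carrier L \<rightarrow> carrier L \<rightarrow> carrier L"
    and imp_greatest: "\<lbrakk>x \<in> carrier L; y \<in> carrier L\<rbrakk>
      \<Longrightarrow> greatest L (imp x y)
            {z \<in> carrier L. Lower L (Upper L {x, y} \<union> {z}) = Lower L {y}}"

locale sectionally_pseudocomplemented_poset_with_one =
  sectionally_pseudocomplemented_poset L imp for L (structure) and imp +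
  fixes e :: 'a
  assumes one_top: "greatest L e (carrier L)"

text \<open>
  The conditions below mention only the set \<open>P\<close> and the operations on it, not the order.
\<close>

definition cond_i :: "'a set \<Rightarrow> ('a \<Rightarrow> 'a \<Rightarrow> 'a) \<Rightarrow> ('a \<Rightarrow> 'a \<Rightarrow> 'a) \<Rightarrow> bool" where
  "cond_i P mt imp \<longleftrightarrow> (\<forall>x\<in>P. \<forall>y\<in>P. mt y (imp x y) = y)"

definition cond_ii ::
    "'a set \<Rightarrow> ('a \<Rightarrow> 'a \<Rightarrow> 'a) \<Rightarrow> ('a \<Rightarrow> 'a \<Rightarrow> 'a) \<Rightarrow> ('a \<Rightarrow> 'a \<Rightarrow> 'a) \<Rightarrow> bool" where
  "cond_ii P jn mt imp \<longleftrightarrow>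
    (\<forall>x\<in>P. \<forall>y\<in>P. \<forall>z\<in>P.
      (\<forall>t\<in>P. mt (mt (jn (jn x t) (jn y t)) z) (mt (imp x y) z) = z) \<longrightarrow> mt z y = z)"

definition cond_iii ::
    "'a set \<Rightarrow> ('a \<Rightarrow> 'a \<Rightarrow> 'a) \<Rightarrow> ('a \<Rightarrow> 'a \<Rightarrow> 'a) \<Rightarrow> ('a \<Rightarrow> 'a \<Rightarrow> 'a) \<Rightarrow> bool" where
  "cond_iii P jn mt imp \<longleftrightarrow>
    (\<forall>x\<in>P. \<forall>y\<in>P. \<forall>z\<in>P.
      (\<forall>s\<in>P. (\<forall>t\<in>P. mt (mt (jn (jn x t) (jn y t)) s) (mt z s) = s) \<longleftrightarrow> mt s y = s)
        \<longrightarrow> mt z (imp x y) = z)"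

definition cond_iv :: "'a set \<Rightarrow> ('a \<Rightarrow> 'a \<Rightarrow> 'a) \<Rightarrow> 'a \<Rightarrow> bool" where
  "cond_iv P mt e \<longleftrightarrow> (\<forall>x\<in>P. mt x e = x)"

end

theory Submission
  imports Defs
begin

text \<open>
  In a \<open>\<lambda>\<close>-lattice the order is recovered from the operations, since \<open>x \<sqinter> y = x\<close> holds
  exactly when \<open>x \<le> y\<close> (\<open>mt_eq_left_iff\<close>). What has to be expressed by operations
  is the lower cone \<open>L(U(x,y),z)\<close>, and this works because the term \<open>(x \<squnion> t) \<squnion> (y \<squnion> t)\<close>
  parametrises the upper cone: all its values lie in \<open>U(x,y)\<close>, and each \<open>u \<in> U(x,y)\<close> is
  its value at \<open>t = u\<close> (\<open>Upper_eq_image\<close>). Hence the premise shared by (ii) and (iii) says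
  precisely that an element belongs to \<open>L(U(x,y),z)\<close> (\<open>cone_equation_iff\<close>).

  After this translation (i) reads \<open>y \<le> x \<circ> y\<close>, (ii) reads \<open>L(U(x,y), x \<circ> y) \<subseteq> L(y)\<close>,
  and (iii) says that \<open>L(U(x,y), z) = L(y)\<close> implies \<open>z \<le> x \<circ> y\<close>. As \<open>y\<close> always lies
  in \<open>L(U(x,y))\<close>, condition (i) is the inclusion \<open>L(y) \<subseteq> L(U(x,y), x \<circ> y)\<close>, so that
  (i) and (ii) state that \<open>x \<circ> y\<close> is one of the elements \<open>z\<close> with \<open>L(U(x,y), z) = L(y)\<close>,
  and (iii) states that it is above all of them. Condition (iv) reads \<open>x \<le> 1\<close>, which
  turns the first equivalence into the one with a top element.
\<close>

context partial_order
begin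

lemma Lower_insert_iff:
  assumes "A \<subseteq> carrier L" "z \<in> carrier L"
  shows "s \<in> Lower L (A \<union> {z}) \<longleftrightarrow> s \<in> carrier L \<and> (\<forall>u\<in>A. s \<sqsubseteq> u) \<and> s \<sqsubseteq> z"
  using assms by (auto simp: Lower_def)

lemma Lower_singleton_iff:
  assumes "y \<in> carrier L"
  shows "s \<in> Lower L {y} \<longleftrightarrow> s \<in> carrier L \<and> s \<sqsubseteq> y"
  using assms by (auto simp: Lower_def)

lemma Upper_pair_iff:
  assumes "x \<in> carrier L" "y \<in> carrier L"
  shows "u \<in> Upper L {x, y} \<longleftrightarrow> u \<in> carrier L \<and> x \<sqsubseteq> u \<and> y \<sqsubseteq> u"
  using assms by (auto simp: Upper_def)

text \<open>
  One inclusion of the cone equation only concerns \<open>y\<close> itself: lower cones are down-closed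
  and \<open>y\<close> is below every element of \<open>U(x,y)\<close>, so it holds as soon as \<open>y \<le> z\<close>.
\<close>

lemma cone_eq_iff:
  assumes x: "x \<in> carrier L" and y: "y \<in> carrier L" and z: "z \<in> carrier L"
  shows "Lower L (Upper L {x, y} \<union> {z}) = Lower L {y} \<longleftrightarrow>
    y \<sqsubseteq> z \<and> Lower L (Upper L {x, y} \<union> {z}) \<subseteq> Lower L {y}"
proof -
  have cone: "s \<in> Lower L (Upper L {x, y} \<union> {z}) \<longleftrightarrow>
      s \<in> carrier L \<and> (\<forall>u\<in>Upper L {x, y}. s \<sqsubseteq> u) \<and> s \<sqsubseteq> z" for s
    using Lower_insert_iff[OF Upper_closed z] .
  have "Lower L {y} \<subseteq> Lower L (Upper L {x, y} \<union> {z}) \<longleftrightarrow> y \<sqsubseteq> z"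
  proof
    assume sub: "Lower L {y} \<subseteq> Lower L (Upper L {x, y} \<union> {z})"
    have "y \<in> Lower L {y}"
      using y by (simp add: Lower_singleton_iff)
    from subsetD[OF sub this] show "y \<sqsubseteq> z"
      unfolding cone by simp
  next
    assume yz: "y \<sqsubseteq> z"
    show "Lower L {y} \<subseteq> Lower L (Upper L {x, y} \<union> {z})"
    proof
      fix s assume "s \<in> Lower L {y}"
      then have s: "s \<in> carrier L" "s \<sqsubseteq> y"
        using y by (simp_all add: Lower_singleton_iff)
      have "s \<sqsubseteq> u" if "u \<in> Upper L {x, y}" for u
        using that s x y le_trans[of s y u] by (simp add: Upper_pair_iff)
      then show "s \<in> Lower L (Upper L {x, y} \<union> {z})"
        using s yz y z le_trans[of s y z]
        unfolding cone by simp
    qed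
  qed
  then show ?thesis unfolding set_eq_subset by argo
qed

lemma sectionally_pseudocomplemented_iff:
  assumes imp: "imp \<in> carrier L \<rightarrow> carrier L \<rightarrow> carrier L"
  shows "sectionally_pseudocomplemented_poset L imp \<longleftrightarrow>
    (\<forall>x\<in>carrier L. \<forall>y\<in>carrier L. y \<sqsubseteq> imp x y) \<and>
    (\<forall>x\<in>carrier L. \<forall>y\<in>carrier L.
      Lower L (Upper L {x, y} \<union> {imp x y}) \<subseteq> Lower L {y}) \<and>
    (\<forall>x\<in>carrier L. \<forall>y\<in>carrier L. \<forall>z\<in>carrier L.
      Lower L (Upper L {x, y} \<union> {z}) = Lower L {y} \<longrightarrow> z \<sqsubseteq> imp x y)"
proof -
  have closed: "imp x y \<in> carrier L" if "x \<in> carrier L" "y \<in> carrier L" for x y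
    using imp that by auto
  have "sectionally_pseudocomplemented_poset L imp \<longleftrightarrow>
      (\<forall>x\<in>carrier L. \<forall>y\<in>carrier L. greatest L (imp x y)
        {z \<in> carrier L. Lower L (Upper L {x, y} \<union> {z}) = Lower L {y}})"
    using imp partial_order_axioms
    by (auto simp: sectionally_pseudocomplemented_poset_def
        sectionally_pseudocomplemented_poset_axioms_def)
  also have "\<dots> \<longleftrightarrow> (\<forall>x\<in>carrier L. \<forall>y\<in>carrier L.
      Lower L (Upper L {x, y} \<union> {imp x y}) = Lower L {y} \<and>
      (\<forall>z\<in>carrier L. Lower L (Upper L {x, y} \<union> {z}) = Lower L {y} \<longrightarrow> z \<sqsubseteq> imp x y))"
    by (intro ball_cong HOL.refl) (auto simp: greatest_def closed)
  also have "\<dots> \<longleftrightarrow> (\<forall>x\<in>carrier L. \<forall>y\<in>carrier L.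
      (y \<sqsubseteq> imp x y \<and> Lower L (Upper L {x, y} \<union> {imp x y}) \<subseteq> Lower L {y}) \<and>
      (\<forall>z\<in>carrier L. Lower L (Upper L {x, y} \<union> {z}) = Lower L {y} \<longrightarrow> z \<sqsubseteq> imp x y))"
    by (intro ball_cong HOL.refl arg_cong2[where f = "(\<and>)"] cone_eq_iff closed)
  finally show ?thesis by (simp only: ball_conj_distrib conj_assoc)
qed

end

context lambda_lattice
begin

lemma jn_closed: "\<lbrakk>x \<in> carrier L; y \<in> carrier L\<rbrakk> \<Longrightarrow> jn x y \<in> carrier L"
  and jn_upper1: "\<lbrakk>x \<in> carrier L; y \<in> carrier L\<rbrakk> \<Longrightarrow> x \<sqsubseteq> jn x y"
  and jn_upper2: "\<lbrakk>x \<in> carrier L; y \<in> carrier L\<rbrakk> \<Longrightarrow> y \<sqsubseteq> jn x y"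
  using jn_Upper[of x y] by (simp_all add: Upper_pair_iff)

lemma mt_closed: "\<lbrakk>x \<in> carrier L; y \<in> carrier L\<rbrakk> \<Longrightarrow> mt x y \<in> carrier L"
  and mt_lower1: "\<lbrakk>x \<in> carrier L; y \<in> carrier L\<rbrakk> \<Longrightarrow> mt x y \<sqsubseteq> x"
  and mt_lower2: "\<lbrakk>x \<in> carrier L; y \<in> carrier L\<rbrakk> \<Longrightarrow> mt x y \<sqsubseteq> y"
  using mt_Lower[of x y] by (auto simp: Lower_def)

lemma jn_absorb:
  assumes "x \<in> carrier L" "y \<in> carrier L" "x \<sqsubseteq> y"
  shows "jn x y = y"
  using jn_max[of x y] assms jn_upper2[of x y] by (auto simp: greatest_def intro: le_antisym)

lemma mt_eq_left_iff:
  assumes "x \<in> carrier L" "y \<in> carrier L"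
  shows "mt x y = x \<longleftrightarrow> x \<sqsubseteq> y"
proof
  assume "mt x y = x"
  then show "x \<sqsubseteq> y" using mt_lower2[OF assms] by simp
next
  assume "x \<sqsubseteq> y"
  then show "mt x y = x"
    using mt_min[of x y] assms mt_lower1[of x y] by (auto simp: least_def intro: le_antisym)
qed

text \<open>
  The operation \<open>\<sqinter>\<close> need not be associative, so a conjunction of two inequalities
  \<open>s \<le> w\<close>, \<open>s \<le> z\<close> cannot be written as \<open>s \<sqinter> (w \<sqinter> z) = s\<close>: the chosen \<open>w \<sqinter> z\<close> may
  fail to be above \<open>s\<close>. Meeting each of \<open>w\<close> and \<open>z\<close> with \<open>s\<close> first avoids this.
\<close>

lemma mt_mt_eq_iff:
  assumes w: "w \<in> carrier L" and z: "z \<in> carrier L" and s: "s \<in> carrier L"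
  shows "mt (mt w s) (mt z s) = s \<longleftrightarrow> s \<sqsubseteq> w \<and> s \<sqsubseteq> z"
proof
  assume eq: "mt (mt w s) (mt z s) = s"
  have "s \<sqsubseteq> mt w s" "s \<sqsubseteq> mt z s"
    using mt_lower1[of "mt w s" "mt z s"] mt_lower2[of "mt w s" "mt z s"] eq w z s
    by (simp_all add: mt_closed)
  then show "s \<sqsubseteq> w \<and> s \<sqsubseteq> z"
    using le_trans[of s "mt w s" w] le_trans[of s "mt z s" z] w z s mt_lower1
    by (simp add: mt_closed)
next
  assume "s \<sqsubseteq> w \<and> s \<sqsubseteq> z"
  then have "mt w s = s" "mt z s = s"
    using w z s mt_eq_left_iff mt_commute by metis+
  then show "mt (mt w s) (mt z s) = s"
    using s by (simp add: mt_eq_left_iff)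
qed

lemma Upper_eq_image:
  assumes x: "x \<in> carrier L" and y: "y \<in> carrier L"
  shows "Upper L {x, y} = (\<lambda>t. jn (jn x t) (jn y t)) ` carrier L"
proof (intro equalityI subsetI)
  fix u assume "u \<in> Upper L {x, y}"
  then have u: "u \<in> carrier L" "x \<sqsubseteq> u" "y \<sqsubseteq> u"
    using x y by (simp_all add: Upper_pair_iff)
  then have "jn (jn x u) (jn y u) = u"
    using x y by (simp add: jn_absorb)
  then show "u \<in> (\<lambda>t. jn (jn x t) (jn y t)) ` carrier L"
    using u by (intro image_eqI[of _ _ u]) simp_all
next
  fix u assume "u \<in> (\<lambda>t. jn (jn x t) (jn y t)) ` carrier L"
  then obtain t where t: "t \<in> carrier L" and u: "u = jn (jn x t) (jn y t)" by blast
  have "x \<sqsubseteq> u"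
    using le_trans[of x "jn x t" u] x y t u by (simp add: jn_closed jn_upper1)
  moreover have "y \<sqsubseteq> u"
    using le_trans[of y "jn y t" u] x y t u by (simp add: jn_closed jn_upper1 jn_upper2)
  ultimately show "u \<in> Upper L {x, y}"
    using x y t u by (simp add: Upper_pair_iff jn_closed)
qed

lemma cone_equation_iff:
  assumes x: "x \<in> carrier L" and y: "y \<in> carrier L" and z: "z \<in> carrier L"
    and s: "s \<in> carrier L"
  shows "(\<forall>t\<in>carrier L. mt (mt (jn (jn x t) (jn y t)) s) (mt z s) = s) \<longleftrightarrow>
    s \<in> Lower L (Upper L {x, y} \<union> {z})"
proof -
  have "(\<forall>t\<in>carrier L. mt (mt (jn (jn x t) (jn y t)) s) (mt z s) = s) \<longleftrightarrow>
      (\<forall>t\<in>carrier L. s \<sqsubseteq> jn (jn x t) (jn y t) \<and> s \<sqsubseteq> z)"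
    using x y z s by (simp add: mt_mt_eq_iff jn_closed)
  \<comment> \<open>The conjunct \<open>s \<le> z\<close> leaves the quantifier because \<open>s\<close> witnesses a nonempty carrier.\<close>
  also have "\<dots> \<longleftrightarrow> (\<forall>u\<in>Upper L {x, y}. s \<sqsubseteq> u) \<and> s \<sqsubseteq> z"
    unfolding Upper_eq_image[OF x y] using s by auto
  also have "\<dots> \<longleftrightarrow> s \<in> Lower L (Upper L {x, y} \<union> {z})"
    unfolding Lower_insert_iff[OF Upper_closed z] using s by simp
  finally show ?thesis .
qed

lemma cond_i_iff:
  assumes imp: "imp \<in> carrier L \<rightarrow> carrier L \<rightarrow> carrier L"
  shows "cond_i (carrier L) mt imp \<longleftrightarrow> (\<forall>x\<in>carrier L. \<forall>y\<in>carrier L. y \<sqsubseteq> imp x y)"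
  unfolding cond_i_def
  by (intro ball_cong HOL.refl mt_eq_left_iff) (use imp in auto)

lemma cond_ii_iff:
  assumes imp: "imp \<in> carrier L \<rightarrow> carrier L \<rightarrow> carrier L"
  shows "cond_ii (carrier L) jn mt imp \<longleftrightarrow> (\<forall>x\<in>carrier L. \<forall>y\<in>carrier L.
    Lower L (Upper L {x, y} \<union> {imp x y}) \<subseteq> Lower L {y})"
  unfolding cond_ii_def
proof (intro ball_cong[OF HOL.refl])
  fix x y assume x: "x \<in> carrier L" and y: "y \<in> carrier L"
  have xy: "imp x y \<in> carrier L" using imp x y by auto
  have "(\<forall>z\<in>carrier L. (\<forall>t\<in>carrier L.
        mt (mt (jn (jn x t) (jn y t)) z) (mt (imp x y) z) = z) \<longrightarrow> mt z y = z) \<longleftrightarrow>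
      (\<forall>z\<in>carrier L. z \<in> Lower L (Upper L {x, y} \<union> {imp x y}) \<longrightarrow> z \<in> Lower L {y})"
    using x y xy by (simp add: cone_equation_iff mt_eq_left_iff Lower_singleton_iff
        del: Un_insert_right)
  also have "\<dots> \<longleftrightarrow> Lower L (Upper L {x, y} \<union> {imp x y}) \<subseteq> Lower L {y}"
    using Lower_closed[of L "Upper L {x, y} \<union> {imp x y}"] by (meson subset_iff)
  finally show "(\<forall>z\<in>carrier L. (\<forall>t\<in>carrier L.
        mt (mt (jn (jn x t) (jn y t)) z) (mt (imp x y) z) = z) \<longrightarrow> mt z y = z) \<longleftrightarrow>
      Lower L (Upper L {x, y} \<union> {imp x y}) \<subseteq> Lower L {y}" .
qed

lemma cond_iii_iff:
  assumes imp: "imp \<in> carrier L \<rightarrow> carrier L \<rightarrow> carrier L"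
  shows "cond_iii (carrier L) jn mt imp \<longleftrightarrow>
    (\<forall>x\<in>carrier L. \<forall>y\<in>carrier L. \<forall>z\<in>carrier L.
      Lower L (Upper L {x, y} \<union> {z}) = Lower L {y} \<longrightarrow> z \<sqsubseteq> imp x y)"
  unfolding cond_iii_def
proof (intro ball_cong[OF HOL.refl] arg_cong2[where f = "(\<longrightarrow>)"] mt_eq_left_iff)
  fix x y z assume x: "x \<in> carrier L" and y: "y \<in> carrier L" and z: "z \<in> carrier L"
  show "imp x y \<in> carrier L" using imp x y by auto
  have sets_eq: "(\<forall>s\<in>C. s \<in> A \<longleftrightarrow> s \<in> B) \<longleftrightarrow> A = B" if "A \<subseteq> C" "B \<subseteq> C" for A B C :: "'a set"
    using that by blast
  have "(\<forall>s\<in>carrier L. (\<forall>t\<in>carrier L.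
        mt (mt (jn (jn x t) (jn y t)) s) (mt z s) = s) \<longleftrightarrow> mt s y = s) \<longleftrightarrow>
      (\<forall>s\<in>carrier L. s \<in> Lower L (Upper L {x, y} \<union> {z}) \<longleftrightarrow> s \<in> Lower L {y})"
    using x y z by (simp add: cone_equation_iff mt_eq_left_iff Lower_singleton_iff
        del: Un_insert_right)
  also have "\<dots> \<longleftrightarrow> Lower L (Upper L {x, y} \<union> {z}) = Lower L {y}"
    by (rule sets_eq[OF Lower_closed Lower_closed])
  finally show "(\<forall>s\<in>carrier L. (\<forall>t\<in>carrier L.
        mt (mt (jn (jn x t) (jn y t)) s) (mt z s) = s) \<longleftrightarrow> mt s y = s) \<longleftrightarrow>
      Lower L (Upper L {x, y} \<union> {z}) = Lower L {y}" .
qed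

lemma cond_iv_iff:
  assumes "e \<in> carrier L"
  shows "cond_iv (carrier L) mt e \<longleftrightarrow> greatest L e (carrier L)"
  using assms by (simp add: cond_iv_def greatest_def mt_eq_left_iff)

lemma sectionally_pseudocomplemented_iff_conds:
  assumes imp: "imp \<in> carrier L \<rightarrow> carrier L \<rightarrow> carrier L"
  shows "sectionally_pseudocomplemented_poset L imp \<longleftrightarrow>
    cond_i (carrier L) mt imp \<and> cond_ii (carrier L) jn mt imp \<and>
    cond_iii (carrier L) jn mt imp"
  unfolding sectionally_pseudocomplemented_iff[OF imp] cond_i_iff[OF imp]
    cond_ii_iff[OF imp] cond_iii_iff[OF imp] ..

end

theorem theorem5p4:
  fixes L (structure)
    and imp jn mt :: "'a \<Rightarrow> 'a \<Rightarrow> 'a"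
  assumes "directed_poset L"
    and "imp \<in> carrier L \<rightarrow> carrier L \<rightarrow> carrier L"
    and "lambda_lattice L jn mt"
  shows "(sectionally_pseudocomplemented_poset L imp \<longleftrightarrow>
        cond_i (carrier L) mt imp \<and> cond_ii (carrier L) jn mt imp \<and>
        cond_iii (carrier L) jn mt imp) \<and>
    (\<forall>e\<in>carrier L. sectionally_pseudocomplemented_poset_with_one L imp e \<longleftrightarrow>
        cond_i (carrier L) mt imp \<and> cond_ii (carrier L) jn mt imp \<and>
        cond_iii (carrier L) jn mt imp \<and> cond_iv (carrier L) mt e)"
proof -
  interpret lambda_lattice L jn mt by fact
  show ?thesis
    using assms(2)
    by (auto simp: sectionally_pseudocomplemented_poset_with_one_def
        sectionally_pseudocomplemented_poset_with_one_axioms_def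
        sectionally_pseudocomplemented_iff_conds cond_iv_iff)
qed

end
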